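(* Let $M$, $N$, $P$, $Q$ be matroids on ground sets $S$, $T$, $U$, $V$ respectively (with $S$ and $T$ disjoint, and $U$ and $V$ disjoint). If the free products satisfy $M\mathbin{\Box} N\cong P\mathbin{\Box} Q$ and $|S|=|U|$, then $M\cong P$ and $N\cong Q$.
   Context: Matroids are on finite ground sets. For a matroid $M$ on $S$ with rank function $\rho_M$, write $\rho(M)=\rho_M(S)$, $\nu_M(A)=|A|-\rho_M(A)$ (nullity) and $\lambda_M(A)=\rho(M)-\rho_M(A)$ (rank-lack) for $A\subseteq S$. For matroids $M$ on $S$ and $N$ on $T$, with $S\cap T=\emptyset$, the free product $M\mathbin{\Box} N$ is the matroid on the disjoint union $S+T$ whose independent sets are exactly those $A\subseteq S+T$ such that $A\cap S$ is independent in $M$ and $\lambda_M(A\cap S)\geq \nu_N(A\cap T)$ (this family is indeed the family of independent sets of a matroid). The symbol $\cong$ denotes isomorphism of matroids, i.e. existence of a bijection of ground sets carrying independent sets exactly to independent sets. *)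

theory Defs
  imports Main
begin

record 'a set_system =
  ground :: "'a set"
  indep :: "'a set set"

locale matroid =
  fixes M :: "'a set_system"
  assumes finite_ground: "finite (ground M)"
    and indep_subset_ground: "A \<in> indep M \<Longrightarrow> A \<subseteq> ground M"
    and empty_indep: "{} \<in> indep M"
    and indep_mono: "A \<in> indep M \<Longrightarrow> B \<subseteq> A \<Longrightarrow> B \<in> indep M"
    and augment: "A \<in> indep M \<Longrightarrow> B \<in> indep M \<Longrightarrow> card A < card B \<Longrightarrow>
      \<exists>x \<in> B - A. insert x A \<in> indep M"

definition rank :: "'a set_system \<Rightarrow> 'a set \<Rightarrow> nat" where
  "rank M A = Max (card ` {X. X \<subseteq> A \<and> X \<in> indep M})"

text \<open>Nullity and rank-lack are integer-valued, so that no subtraction is truncated.\<close>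

definition nullity :: "'a set_system \<Rightarrow> 'a set \<Rightarrow> int" where
  "nullity M A = int (card A) - int (rank M A)"

definition rank_lack :: "'a set_system \<Rightarrow> 'a set \<Rightarrow> int" where
  "rank_lack M A = int (rank M (ground M)) - int (rank M A)"

text \<open>The disjoint union of the ground sets is rendered as their union, so the definition is
  only meaningful when the ground sets are disjoint.\<close>

definition free_product :: "'a set_system \<Rightarrow> 'a set_system \<Rightarrow> 'a set_system" where
  "free_product M N =
    \<lparr>ground = ground M \<union> ground N,
     indep = {A. A \<subseteq> ground M \<union> ground N \<and> A \<inter> ground M \<in> indep M \<and>
       rank_lack M (A \<inter> ground M) \<ge> nullity N (A \<inter> ground N)}\<rparr>"

definition matroid_iso :: "'a set_system \<Rightarrow> 'b set_system \<Rightarrow> bool" where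
  "matroid_iso M N \<longleftrightarrow> (\<exists>f. bij_betw f (ground M) (ground N) \<and>
    (\<forall>A. A \<subseteq> ground M \<longrightarrow> (A \<in> indep M \<longleftrightarrow> f ` A \<in> indep N)))"

end

theory Submission
  imports Defs
begin

text \<open>
  Transporting along the isomorphism, a single matroid \<open>L\<close> is a free product in two ways, with
  first ground sets \<open>A\<close> and \<open>B\<close> of equal size. In a free product, the closure of every circuit
  is comparable to the first ground set. Hence, if \<open>A \<noteq> B\<close>, the closure of every circuit is
  contained in \<open>A \<inter> B\<close> or contains \<open>A \<union> B\<close>. A set is dependent iff it meets the closure of some
  circuit in more elements than the rank of that closure, so every permutation that moves
  only elements of the symmetric difference of \<open>A\<close> and \<open>B\<close> is an automorphism of \<open>L\<close>. One
  such permutation carries \<open>A\<close> to \<open>B\<close>. After composing with it, the isomorphism respects the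
  decompositions, and the factors are recovered as restriction to and contraction of the
  first ground set.
\<close>

section \<open>Rank\<close>

context matroid
begin

lemma indep_finite: "A \<in> indep M \<Longrightarrow> finite A"
  using finite_ground indep_subset_ground finite_subset by blast

lemma finite_indep_below: "finite {X. X \<subseteq> A \<and> X \<in> indep M}"
  by (rule finite_subset[of _ "Pow (ground M)"]) (use finite_ground indep_subset_ground in auto)

lemma card_le_rank: "X \<in> indep M \<Longrightarrow> X \<subseteq> A \<Longrightarrow> card X \<le> rank M A"
  unfolding rank_def by (rule Max_ge) (use finite_indep_below in auto)

lemma rank_obtains:
  obtains X where "X \<subseteq> A" "X \<in> indep M" "card X = rank M A"
proof -
  have "rank M A \<in> card ` {X. X \<subseteq> A \<and> X \<in> indep M}"
    unfolding rank_def by (rule Max_in) (use finite_indep_below empty_indep in auto)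
  then show ?thesis using that by auto
qed

lemma rank_mono: "A \<subseteq> B \<Longrightarrow> rank M A \<le> rank M B"
  by (metis rank_obtains card_le_rank order_trans)

lemma rank_le_card: "finite A \<Longrightarrow> rank M A \<le> card A"
  by (metis rank_obtains card_mono)

lemma rank_indep: "A \<in> indep M \<Longrightarrow> rank M A = card A"
  by (meson card_le_rank rank_le_card indep_finite order_antisym order_refl)

lemma indep_iff_rank: "finite A \<Longrightarrow> A \<in> indep M \<longleftrightarrow> rank M A = card A"
  by (metis rank_indep rank_obtains card_subset_eq)

lemma rank_insert_le: "rank M (insert x A) \<le> Suc (rank M A)"
proof -
  obtain X where X: "X \<subseteq> insert x A" "X \<in> indep M" "card X = rank M (insert x A)"
    by (rule rank_obtains)
  have "X - {x} \<in> indep M" using X(2) indep_mono by blast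
  then have "card (X - {x}) \<le> rank M A" using X(1) by (intro card_le_rank) auto
  moreover have "card X \<le> Suc (card (X - {x}))"
    using indep_finite[OF X(2)] card_Suc_Diff1[of X x] by (cases "x \<in> X") auto
  ultimately show ?thesis using X(3) by linarith
qed

text \<open>Augment a maximal independent subset of \<open>A\<close> from one of \<open>B\<close>.
  The element found is outside \<open>A\<close>, since otherwise \<open>A\<close> would contain an
  independent set larger than its rank.\<close>

lemma rank_less_obtains:
  assumes "rank M A < rank M B"
  obtains b where "b \<in> B - A" "rank M (insert b A) = Suc (rank M A)"
proof -
  obtain X where X: "X \<subseteq> A" "X \<in> indep M" "card X = rank M A" by (rule rank_obtains)
  obtain Y where Y: "Y \<subseteq> B" "Y \<in> indep M" "card Y = rank M B" by (rule rank_obtains)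
  obtain b where b: "b \<in> Y - X" "insert b X \<in> indep M" using augment[OF X(2) Y(2)] X Y assms by auto
  have c: "card (insert b X) = Suc (rank M A)" using b X indep_finite by auto
  have "b \<notin> A" using card_le_rank[OF b(2), of A] c X(1) by auto
  moreover have "rank M (insert b A) = Suc (rank M A)"
    using card_le_rank[OF b(2), of "insert b A"] c insert_mono[OF X(1), of b]
      rank_insert_le[of b A] by linarith
  ultimately show ?thesis using that b Y by auto
qed

lemma rank_lack_nonneg: "A \<subseteq> ground M \<Longrightarrow> 0 \<le> rank_lack M A"
  unfolding rank_lack_def using rank_mono[of A "ground M"] by auto

lemma rank_lack_insert:
  assumes "insert x A \<in> indep M" "x \<notin> A"
  shows "rank_lack M (insert x A) = rank_lack M A - 1"
proof -
  have "A \<in> indep M" using assms indep_mono by blast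
  then show ?thesis using assms indep_finite by (simp add: rank_lack_def rank_indep)
qed

text \<open>Adding a new element raises the cardinality by one and the rank by at most one.\<close>

lemma nullity_mono:
  assumes "finite B" "A \<subseteq> B" shows "nullity M A \<le> nullity M B"
proof -
  have "finite A" using assms finite_subset by blast
  then show ?thesis using assms(2,1)
  proof (induction "card (B - A)" arbitrary: A)
    case 0
    then have "A = B" by auto
    then show ?case by simp
  next
    case (Suc n)
    then obtain x where x: "x \<in> B - A" by (metis card_eq_0_iff equals0I nat.distinct(1))
    have d: "B - insert x A = B - A - {x}" by auto
    have "n = card (B - insert x A)" using x Suc.hyps(2) unfolding d by simp
    then have "nullity M (insert x A) \<le> nullity M B" using Suc x by auto
    moreover have "nullity M A \<le> nullity M (insert x A)"
      using x Suc.prems rank_insert_le[of x A] by (simp add: nullity_def)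
    ultimately show ?case by linarith
  qed
qed

lemma nullity_insert_le: "finite A \<Longrightarrow> nullity M (insert x A) \<le> nullity M A + 1"
  using rank_mono[OF subset_insertI, of A x] by (simp add: nullity_def card_insert_if)

lemma nullity_empty: "nullity M {} = 0"
  using rank_indep[OF empty_indep] by (simp add: nullity_def)

lemma nullity_le_0_iff: "finite A \<Longrightarrow> nullity M A \<le> 0 \<longleftrightarrow> A \<in> indep M"
  using indep_iff_rank[of A] rank_le_card[of A] by (auto simp: nullity_def)

end

section \<open>Free products\<close>

text \<open>In a matroid this is the usual closure when \<open>B\<close> is independent, as
  \<open>C - {c}\<close> is for a circuit \<open>C\<close>; for dependent \<open>B\<close> it is the
  whole ground set.\<close>

definition closure :: "'a set_system \<Rightarrow> 'a set \<Rightarrow> 'a set" where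
  "closure L B = {x \<in> ground L. insert x B \<in> indep L \<longrightarrow> x \<in> B}"

definition circuit :: "'a set_system \<Rightarrow> 'a set \<Rightarrow> bool" where
  "circuit L C \<longleftrightarrow> C \<subseteq> ground L \<and> C \<notin> indep L \<and> (\<forall>x\<in>C. C - {x} \<in> indep L)"

text \<open>Since \<open>C - {c}\<close> is a basis of the circuit \<open>C\<close>, its closure is that of \<open>C\<close>.\<close>

definition free_separator :: "'a set_system \<Rightarrow> 'a set \<Rightarrow> bool" where
  "free_separator L A \<longleftrightarrow> A \<subseteq> ground L \<and>
    (\<forall>C c. circuit L C \<longrightarrow> c \<in> C \<longrightarrow> closure L (C - {c}) \<subseteq> A \<or> A \<subseteq> closure L (C - {c}))"

locale matroid_pair = M: matroid M + N: matroid N for M N :: "'a set_system" +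
  assumes disjoint: "ground M \<inter> ground N = {}"
begin

abbreviation "S \<equiv> ground M"
abbreviation "T \<equiv> ground N"
abbreviation "L \<equiv> free_product M N"

lemma ground_L [simp]: "ground L = S \<union> T"
  by (simp add: free_product_def)

lemma indep_L: "A \<in> indep L \<longleftrightarrow> A \<subseteq> S \<union> T \<and> A \<inter> S \<in> indep M \<and>
    nullity N (A \<inter> T) \<le> rank_lack M (A \<inter> S)"
  by (auto simp: free_product_def)

lemma insert_fst: "s \<in> S \<Longrightarrow> insert s A \<inter> S = insert s (A \<inter> S) \<and> insert s A \<inter> T = A \<inter> T"
  using disjoint by auto

lemma insert_snd: "t \<in> T \<Longrightarrow> insert t A \<inter> S = A \<inter> S \<and> insert t A \<inter> T = insert t (A \<inter> T)"
  using disjoint by auto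

lemma finite_snd: "finite (A \<inter> T)"
  using N.finite_ground by auto

lemma card_split: "A \<subseteq> S \<union> T \<Longrightarrow> card A = card (A \<inter> S) + card (A \<inter> T)"
  using disjoint M.finite_ground N.finite_ground
  by (subst card_Un_disjoint[symmetric]) (auto intro!: arg_cong[where f = card])

lemma matroid_free_product: "matroid L"
proof
  show "finite (ground L)" using M.finite_ground N.finite_ground by simp
  show "A \<subseteq> ground L" if "A \<in> indep L" for A using that by (simp add: indep_L)
  show "{} \<in> indep L"
    using M.empty_indep M.rank_lack_nonneg[of "{}"] by (simp add: indep_L N.nullity_empty)
  show "B \<in> indep L" if A: "A \<in> indep L" and BA: "B \<subseteq> A" for A B
  proof -
    have "B \<inter> S \<subseteq> A \<inter> S" "B \<inter> T \<subseteq> A \<inter> T" using BA by auto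
    then show ?thesis
      using A BA M.indep_mono M.rank_mono[of "B \<inter> S" "A \<inter> S"]
        N.nullity_mono[OF finite_snd, of "B \<inter> T" A]
      by (force simp: indep_L rank_lack_def)
  qed
  show "\<exists>x \<in> B - A. insert x A \<in> indep L"
    if A: "A \<in> indep L" and B: "B \<in> indep L" and AB: "card A < card B" for A B
  proof (cases "nullity N (A \<inter> T) < rank_lack M (A \<inter> S)")
    \<comment> \<open>There is slack of at least one: a new element of \<open>T\<close> costs at
      most one in nullity, and an element of \<open>S\<close> that keeps the \<open>M\<close>-part
      independent costs exactly one in rank-lack. Either may be added.\<close>
    case lt: True
    show ?thesis
    proof (cases "B \<inter> T \<subseteq> A")
      case True
      then have "card (B \<inter> T) \<le> card (A \<inter> T)" using finite_snd by (intro card_mono) auto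
      then have "card (A \<inter> S) < card (B \<inter> S)"
        using card_split[of A] card_split[of B] A B AB by (auto simp: indep_L)
      then obtain s where s: "s \<in> B \<inter> S - A \<inter> S" "insert s (A \<inter> S) \<in> indep M"
        using M.augment A B unfolding indep_L by meson
      have "insert s A \<in> indep L"
        using s A lt M.rank_lack_insert[OF s(2)] insert_fst[of s A] by (auto simp: indep_L)
      then show ?thesis using s by auto
    next
      case False
      then obtain t where t: "t \<in> B" "t \<in> T" "t \<notin> A" by auto
      have "insert t A \<in> indep L"
        using t A lt N.nullity_insert_le[OF finite_snd, of t A] insert_snd[of t A]
        by (auto simp: indep_L)
      then show ?thesis using t by auto
    qed
  next
    case False
    \<comment> \<open>The right-hand side is zero for \<open>A\<close>, where the inequality is
      tight, and at most zero for \<open>B\<close>. Hence \<open>card A < card B\<close> forces the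
      rank in \<open>N\<close> to be larger on \<open>B\<close>. An element of \<open>T\<close> that
      raises this rank leaves the nullity unchanged, so it can be added to \<open>A\<close>.\<close>
    have split: "int (card X) - int (rank M S) - int (rank N (X \<inter> T))
        = nullity N (X \<inter> T) - rank_lack M (X \<inter> S)" if "X \<in> indep L" for X
      using that card_split[of X] by (simp add: indep_L nullity_def rank_lack_def M.rank_indep)
    have "rank N (A \<inter> T) < rank N (B \<inter> T)"
      using split[OF A] split[OF B] A B AB False by (simp add: indep_L)
    then obtain t where t: "t \<in> B \<inter> T - A \<inter> T"
        "rank N (insert t (A \<inter> T)) = Suc (rank N (A \<inter> T))"
      by (rule N.rank_less_obtains)
    have "t \<notin> A \<inter> T" using t(1) by blast
    then have "nullity N (insert t (A \<inter> T)) = nullity N (A \<inter> T)"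
      unfolding nullity_def t(2) using card_insert_disjoint[OF finite_snd] by simp
    then have "insert t A \<in> indep L" using t A insert_snd[of t A] by (auto simp: indep_L)
    then show ?thesis using t by auto
  qed
qed

text \<open>Without slack, a new element of \<open>S\<close> either makes the \<open>M\<close>-part
  dependent or pushes the rank-lack below the nullity.\<close>

lemma fst_subset_closure:
  assumes "rank_lack M (B \<inter> S) \<le> nullity N (B \<inter> T)"
  shows "S \<subseteq> closure L B"
proof
  fix s assume s: "s \<in> S"
  have "s \<in> B" if i: "insert s B \<in> indep L"
  proof (rule ccontr)
    assume "s \<notin> B"
    then show False
      using i assms insert_fst[OF s, of B] M.rank_lack_insert[of s "B \<inter> S"] by (auto simp: indep_L)
  qed
  then show "s \<in> closure L B" using s by (auto simp: closure_def)
qed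

text \<open>If \<open>C - {c}\<close> has no slack, its closure contains \<open>S\<close>. If it has
  slack, \<open>C\<close> is dependent because of its \<open>M\<close>-part alone; then minimality
  gives \<open>C \<subseteq> S\<close>, and the slack keeps all of \<open>T\<close> out of the
  closure.\<close>

lemma free_separator_fst: "free_separator L S"
  unfolding free_separator_def
proof (intro conjI allI impI)
  interpret L: matroid L by (rule matroid_free_product)
  show "S \<subseteq> ground L" by simp
  fix C c assume C: "circuit L C" and c: "c \<in> C"
  let ?B = "C - {c}"
  have CB: "C = insert c ?B" using c by auto
  have B: "?B \<in> indep L" and dep: "C \<notin> indep L" and g: "C \<subseteq> S \<union> T"
    using C c by (auto simp: circuit_def)
  show "closure L ?B \<subseteq> S \<or> S \<subseteq> closure L ?B"
  proof (cases "rank_lack M (?B \<inter> S) \<le> nullity N (?B \<inter> T)")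
    case True
    then show ?thesis by (simp add: fst_subset_closure)
  next
    case False
    \<comment> \<open>Otherwise restoring \<open>c\<close> would change nullity or rank-lack by at
      most one, which the slack of \<open>?B\<close> absorbs, and \<open>C\<close> would be
      independent.\<close>
    have "C \<inter> S \<notin> indep M"
    proof
      assume i: "C \<inter> S \<in> indep M"
      then have lt: "rank_lack M (C \<inter> S) < nullity N (C \<inter> T)"
        using dep g by (auto simp: indep_L)
      show False
      proof (cases "c \<in> S")
        case True
        have "C \<inter> S = insert c (?B \<inter> S)" "C \<inter> T = ?B \<inter> T" using True c disjoint by auto
        then show False using i lt False M.rank_lack_insert[of c "?B \<inter> S"] by auto
      next
        case nS: False
        have "C \<inter> S = ?B \<inter> S" "C \<inter> T = insert c (?B \<inter> T)" using nS c g by auto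
        then show False using lt False N.nullity_insert_le[OF finite_snd, of c "?B"] by auto
      qed
    qed
    have CS: "C \<subseteq> S"
    proof (rule ccontr)
      assume "\<not> C \<subseteq> S"
      then obtain t where t: "t \<in> C" "t \<notin> S" by auto
      then have "C - {t} \<in> indep L" using C by (auto simp: circuit_def)
      moreover have "(C - {t}) \<inter> S = C \<inter> S" using t by auto
      ultimately show False using \<open>C \<inter> S \<notin> indep M\<close> by (simp add: indep_L)
    qed
    have "x \<in> S" if x: "x \<in> closure L ?B" for x
    proof (rule ccontr)
      assume "x \<notin> S"
      then have T: "x \<in> T" "x \<notin> ?B" using x CS by (auto simp: closure_def)
      have BT: "?B \<inter> T = {}" using CS disjoint by auto
      have "insert x ?B \<in> indep L"
        using B T False insert_snd[OF T(1), of ?B] N.nullity_insert_le[of "{}" x]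
        by (auto simp: indep_L BT N.nullity_empty)
      then show False using x T by (auto simp: closure_def)
    qed
    then show ?thesis by auto
  qed
qed

lemma indep_fst: "A \<subseteq> S \<Longrightarrow> A \<in> indep L \<longleftrightarrow> A \<in> indep M"
proof -
  assume A: "A \<subseteq> S"
  then have "A \<inter> S = A" "A \<inter> T = {}" using disjoint by auto
  then show ?thesis using A M.rank_lack_nonneg[OF A] by (auto simp: indep_L N.nullity_empty)
qed

text \<open>A basis of \<open>M\<close> has rank-lack zero, so the defining inequality says that
  \<open>A\<close> has nullity at most zero. This exhibits \<open>N\<close> as the contraction of
  the product by \<open>S\<close>.\<close>

lemma indep_snd:
  assumes "B \<in> indep M" "card B = rank M S" "A \<subseteq> T"
  shows "B \<union> A \<in> indep L \<longleftrightarrow> A \<in> indep N"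
proof -
  have "(B \<union> A) \<inter> S = B" "(B \<union> A) \<inter> T = A" "B \<union> A \<subseteq> S \<union> T"
    using disjoint assms M.indep_subset_ground[of B] by auto
  moreover have "rank_lack M B = 0" using assms by (simp add: rank_lack_def M.rank_indep)
  moreover have "finite A" using assms(3) N.finite_ground finite_subset by blast
  ultimately show ?thesis using assms by (simp add: indep_L N.nullity_le_0_iff)
qed

end

section \<open>Isomorphisms\<close>

text \<open>\<open>matroid_iso\<close> with its bijection made explicit, so that it can be composed
  with a permutation.\<close>

definition iso_map :: "('a \<Rightarrow> 'b) \<Rightarrow> 'a set_system \<Rightarrow> 'b set_system \<Rightarrow> bool" where
  "iso_map f M N \<longleftrightarrow> bij_betw f (ground M) (ground N) \<and>
    (\<forall>A. A \<subseteq> ground M \<longrightarrow> (A \<in> indep M \<longleftrightarrow> f ` A \<in> indep N))"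

lemma iso_map_comp:
  assumes f: "iso_map f L M" and g: "iso_map g M N"
  shows "iso_map (g \<circ> f) L N"
  unfolding iso_map_def
proof (intro conjI allI impI)
  show "bij_betw (g \<circ> f) (ground L) (ground N)"
    using f g bij_betw_trans by (metis iso_map_def)
  fix A assume A: "A \<subseteq> ground L"
  then have "f ` A \<subseteq> ground M" using f by (auto simp: iso_map_def bij_betw_def)
  then show "A \<in> indep L \<longleftrightarrow> (g \<circ> f) ` A \<in> indep N"
    using A f g by (simp add: iso_map_def image_image)
qed

lemma iso_map_rank_ground:
  assumes "matroid M" "iso_map f M N"
    and sub: "\<And>A. A \<in> indep N \<Longrightarrow> A \<subseteq> ground N"
  shows "rank N (ground N) = rank M (ground M)"
proof -
  interpret matroid M by fact
  have inj: "inj_on f (ground M)" and im: "f ` ground M = ground N"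
    and ind: "\<And>A. A \<subseteq> ground M \<Longrightarrow> A \<in> indep M \<longleftrightarrow> f ` A \<in> indep N"
    using assms(2) by (auto simp: iso_map_def bij_betw_def)
  have "{X. X \<subseteq> ground N \<and> X \<in> indep N} = image f ` {X. X \<subseteq> ground M \<and> X \<in> indep M}"
    using ind by (auto simp: im[symmetric] subset_image_iff)
  moreover have "card ` image f ` {X. X \<subseteq> ground M \<and> X \<in> indep M}
      = card ` {X. X \<subseteq> ground M \<and> X \<in> indep M}"
    unfolding image_image using inj by (intro image_cong refl card_image) (auto intro: inj_on_subset)
  ultimately show ?thesis by (simp add: rank_def)
qed

text \<open>Circuits and closures are defined from independence alone, so an isomorphism transports
  them. This brings the first ground set of the second product into the first product.\<close>

lemma free_separator_vimage:
  assumes f: "iso_map f L L'" and sep: "free_separator L' U"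
  shows "free_separator L {x \<in> ground L. f x \<in> U}"
  unfolding free_separator_def
proof (intro conjI allI impI)
  show "{x \<in> ground L. f x \<in> U} \<subseteq> ground L" by auto
  have inj: "inj_on f (ground L)" and im: "f ` ground L = ground L'"
    and ind: "\<And>A. A \<subseteq> ground L \<Longrightarrow> A \<in> indep L \<longleftrightarrow> f ` A \<in> indep L'"
    using f by (auto simp: iso_map_def bij_betw_def)
  fix C c assume C: "circuit L C" and c: "c \<in> C"
  have g: "C \<subseteq> ground L" using C by (simp add: circuit_def)
  have img: "f ` (C - {x}) = f ` C - {f x}" if "x \<in> C" for x
    using inj that g by (auto simp: inj_on_def)
  have rem: "f ` C - {f x} \<in> indep L'" if "x \<in> C" for x
    using that C ind[of "C - {x}"] g img[OF that] by (auto simp: circuit_def)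
  have "circuit L' (f ` C)"
    using C ind[OF g] g rem by (auto simp: circuit_def im[symmetric])
  moreover have cl: "x \<in> closure L (C - {c}) \<longleftrightarrow> f x \<in> closure L' (f ` C - {f c})"
    if x: "x \<in> ground L" for x
  proof -
    have sub: "insert x (C - {c}) \<subseteq> ground L" using x g by auto
    have "x \<in> C - {c} \<longleftrightarrow> f x \<in> f ` C - {f c}"
      using inj x g c by (auto simp: inj_on_def)
    then show ?thesis using ind[OF sub] img[OF c] x by (auto simp: closure_def im[symmetric])
  qed
  ultimately have "closure L' (f ` C - {f c}) \<subseteq> U \<or> U \<subseteq> closure L' (f ` C - {f c})"
    using sep c by (auto simp: free_separator_def)
  moreover have "closure L (C - {c}) \<subseteq> ground L" by (auto simp: closure_def)
  ultimately show "closure L (C - {c}) \<subseteq> {x \<in> ground L. f x \<in> U} \<or>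
      {x \<in> ground L. f x \<in> U} \<subseteq> closure L (C - {c})"
    using cl by blast
qed

section \<open>Permuting the symmetric difference of two free separators\<close>

context matroid
begin

lemma contains_circuit:
  assumes "A \<subseteq> ground M" "A \<notin> indep M"
  obtains C where "C \<subseteq> A" "circuit M C"
proof -
  have "finite A" using assms finite_ground finite_subset by blast
  then have "\<exists>C \<subseteq> A. circuit M C" using assms
  proof (induction A rule: finite_psubset_induct)
    case (psubset A)
    show ?case
    proof (cases "circuit M A")
      case False
      then obtain x where "x \<in> A" "A - {x} \<notin> indep M" using psubset.prems by (auto simp: circuit_def)
      then show ?thesis using psubset.IH[of "A - {x}"] psubset.prems by blast
    qed auto
  qed
  then show ?thesis using that by auto
qed

text \<open>Otherwise \<open>B\<close> could be augmented from \<open>A \<inter> closure M B\<close>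
  by a new element, which the closure excludes.\<close>

lemma card_Int_closure_le:
  assumes "A \<in> indep M" "B \<in> indep M"
  shows "card (A \<inter> closure M B) \<le> card B"
proof (rule ccontr)
  assume "\<not> ?thesis"
  moreover have "A \<inter> closure M B \<in> indep M" using assms indep_mono by blast
  ultimately obtain x where "x \<in> A \<inter> closure M B - B" "insert x B \<in> indep M"
    using augment[OF assms(2)] by (meson not_le)
  then show False by (auto simp: closure_def)
qed

text \<open>A circuit inside \<open>A\<close> lies in the closure of \<open>C - {c}\<close>, so
  \<open>A\<close> meets that closure in at least \<open>card C\<close> elements. Stated through
  cardinalities, dependence is visibly invariant under any permutation that maps each such closure
  onto itself.\<close>

lemma dependent_iff:
  assumes "A \<subseteq> ground M"
  shows "A \<notin> indep M \<longleftrightarrow> (\<exists>C c. circuit M C \<and> c \<in> C \<and>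
    card (C - {c}) < card (A \<inter> closure M (C - {c})))"
proof
  assume "A \<notin> indep M"
  then obtain C where C: "C \<subseteq> A" "circuit M C" using contains_circuit assms by blast
  have "C \<noteq> {}" using C empty_indep by (auto simp: circuit_def)
  then obtain c where c: "c \<in> C" by auto
  have "C \<subseteq> closure M (C - {c})"
    using C c by (auto simp: circuit_def closure_def insert_absorb)
  then have "C \<subseteq> A \<inter> closure M (C - {c})" using C by auto
  moreover have "finite A" using assms finite_ground finite_subset by blast
  ultimately have "card C \<le> card (A \<inter> closure M (C - {c}))" "finite C"
    by (auto intro: card_mono finite_subset)
  then have "card (C - {c}) < card (A \<inter> closure M (C - {c}))"
    using c card_Diff1_less[of C c] by auto
  then show "\<exists>C c. circuit M C \<and> c \<in> C \<and> card (C - {c}) < card (A \<inter> closure M (C - {c}))"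
    using C(2) c by blast
next
  assume "\<exists>C c. circuit M C \<and> c \<in> C \<and> card (C - {c}) < card (A \<inter> closure M (C - {c}))"
  then show "A \<notin> indep M" using card_Int_closure_le by (force simp: circuit_def)
qed

lemma iso_map_swap_free_separators:
  assumes sep: "free_separator M A" "free_separator M B"
    and card: "card A = card B"
    and p: "bij_betw p (ground M) (ground M)"
    and fix_p: "\<And>x. x \<in> ground M \<Longrightarrow> (x \<in> A \<longleftrightarrow> x \<in> B) \<Longrightarrow> p x = x"
  shows "iso_map p M M"
proof -
  have inj: "inj_on p (ground M)" and im: "p ` ground M = ground M"
    using p by (auto simp: bij_betw_def)
  have "finite A" "finite B"
    using sep finite_ground by (auto simp: free_separator_def intro: finite_subset)
  then have antichain: "A \<subseteq> B \<or> B \<subseteq> A \<Longrightarrow> A = B"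
    using card card_subset_eq by metis
  \<comment> \<open>By injectivity \<open>p x\<close> is moved too, so both points lie in the
    symmetric difference.\<close>
  have moved: "x \<in> (A \<union> B) - A \<inter> B \<and> p x \<in> (A \<union> B) - A \<inter> B"
    if x: "x \<in> ground M" and ne: "p x \<noteq> x" for x
  proof -
    have "p x \<in> ground M" using x im by auto
    then have "p (p x) \<noteq> p x" using ne x inj by (auto dest: inj_onD)
    then show ?thesis using fix_p x \<open>p x \<in> ground M\<close> ne by blast
  qed
  have stab: "p x \<in> closure M (C - {c}) \<longleftrightarrow> x \<in> closure M (C - {c})"
    if C: "circuit M C" "c \<in> C" and x: "x \<in> ground M" for C c x
  proof -
    let ?F = "closure M (C - {c})"
    have "?F \<subseteq> A \<or> A \<subseteq> ?F" "?F \<subseteq> B \<or> B \<subseteq> ?F"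
      using sep C by (auto simp: free_separator_def)
    \<comment> \<open>In the mixed cases \<open>?F\<close> lies between the two separators, and
      equal sizes force \<open>A = B\<close>, so nothing moves. Otherwise the symmetric difference
      lies inside \<open>?F\<close> or is disjoint from it, and a moved point cannot cross its
      boundary.\<close>
    then have "A \<union> B \<subseteq> ?F \<or> ?F \<subseteq> A \<inter> B \<or> A = B" using antichain by blast
    then show ?thesis using moved[OF x] by (cases "p x = x") (simp, blast)
  qed
  show ?thesis
    unfolding iso_map_def
  proof (intro conjI p allI impI)
    fix X assume X: "X \<subseteq> ground M"
    have pX: "p ` X \<subseteq> ground M" using X im by auto
    have "card (p ` X \<inter> closure M (C - {c})) = card (X \<inter> closure M (C - {c}))"
      if C: "circuit M C" "c \<in> C" for C c
    proof -
      have "p ` X \<inter> closure M (C - {c}) = p ` (X \<inter> closure M (C - {c}))"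
        using stab[OF C] X by auto
      moreover have "inj_on p (X \<inter> closure M (C - {c}))"
        using inj X by (auto intro: inj_on_subset)
      ultimately show ?thesis by (simp add: card_image)
    qed
    then show "X \<in> indep M \<longleftrightarrow> p ` X \<in> indep M"
      using dependent_iff[OF X] dependent_iff[OF pX] by metis
  qed
qed

end

lemma swap_bij_obtains:
  assumes fin: "finite E" and sub: "A \<subseteq> E" "B \<subseteq> E" and card: "card A = card B"
  obtains p where "bij_betw p E E" "p ` A = B" "\<And>x. (x \<in> A \<longleftrightarrow> x \<in> B) \<Longrightarrow> p x = x"
proof -
  have f: "finite A" "finite B" using assms finite_subset by auto
  have "card A = card (A - B) + card (A \<inter> B)" "card B = card (B - A) + card (A \<inter> B)"
    using f by (simp_all add: card_Diff_subset_Int Int_commute card_mono)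
  then have "card (A - B) = card (B - A)" using card by simp
  then obtain h where h: "bij_betw h (A - B) (B - A)"
    using f finite_same_card_bij[of "A - B" "B - A"] by auto
  let ?k = "inv_into (A - B) h"
  define p where "p x = (if x \<in> A - B then h x else if x \<in> B - A then ?k x else x)" for x
  have hB: "h x \<in> B - A" "?k (h x) = x" if "x \<in> A - B" for x
    using h that bij_betw_apply[OF h that] bij_betw_inv_into_left[OF h that] by auto
  have kA: "?k x \<in> A - B" "h (?k x) = x" if "x \<in> B - A" for x
    using h that bij_betw_apply[OF bij_betw_inv_into[OF h] that] bij_betw_inv_into_right[OF h that]
    by auto
  have invol: "p (p x) = x" for x
    unfolding p_def using hB[of x] kA[of x] by auto
  have "p x \<in> E" if "x \<in> E" for x
    unfolding p_def using that hB[of x] kA[of x] sub by auto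
  then have "bij_betw p E E"
    by (intro bij_betw_byWitness[where f' = p]) (auto simp: invol)
  moreover have "p x \<in> B" if "x \<in> A" for x
    unfolding p_def using that hB[of x] by auto
  moreover have "p x \<in> A" if "x \<in> B" for x
    unfolding p_def using that kA[of x] by auto
  ultimately have "p ` A = B" by (force simp: image_iff invol)
  moreover have "p x = x" if "x \<in> A \<longleftrightarrow> x \<in> B" for x
    using that by (auto simp: p_def)
  ultimately show ?thesis using that \<open>bij_betw p E E\<close> by blast
qed

section \<open>Uniqueness of the factors\<close>

lemma matroid_iso_factors:
  fixes M N :: "'a set_system" and P Q :: "'b set_system"
  assumes "matroid_pair M N" "matroid_pair P Q"
    and g: "iso_map g (free_product M N) (free_product P Q)" and im: "g ` ground M = ground P"
  shows "matroid_iso M P \<and> matroid_iso N Q"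
proof -
  interpret MN: matroid_pair M N by fact
  interpret PQ: matroid_pair P Q by fact
  have inj: "inj_on g (ground M \<union> ground N)"
    and img: "g ` (ground M \<union> ground N) = ground P \<union> ground Q"
    and ind: "\<And>A. A \<subseteq> ground M \<union> ground N \<Longrightarrow>
      A \<in> indep (free_product M N) \<longleftrightarrow> g ` A \<in> indep (free_product P Q)"
    using g by (auto simp: iso_map_def bij_betw_def)
  have MP: "iso_map g M P"
    unfolding iso_map_def
  proof (intro conjI allI impI)
    show "bij_betw g (ground M) (ground P)"
      using inj im by (auto simp: bij_betw_def intro: inj_on_subset)
    fix A assume A: "A \<subseteq> ground M"
    then have "g ` A \<subseteq> ground P" using im by auto
    then show "A \<in> indep M \<longleftrightarrow> g ` A \<in> indep P"
      using A ind[of A] MN.indep_fst[of A] PQ.indep_fst[of "g ` A"] by auto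
  qed
  have imN: "g ` ground N = ground Q"
  proof -
    have "g ` ground N = g ` (ground M \<union> ground N) - g ` ground M"
      using inj MN.disjoint by (auto simp: inj_on_def)
    then show ?thesis using img im PQ.disjoint by auto
  qed
  \<comment> \<open>A basis of \<open>M\<close>, whose image is a basis of \<open>P\<close> because
    \<open>g\<close> preserves rank. Adjoining these bases on the two sides reduces independence in
    \<open>N\<close> and in \<open>Q\<close> to independence in the products.\<close>
  obtain B where B: "B \<subseteq> ground M" "B \<in> indep M" "card B = rank M (ground M)"
    by (rule MN.M.rank_obtains)
  have gB: "g ` B \<in> indep P" using MP B by (auto simp: iso_map_def)
  have "card (g ` B) = card B" using inj B by (intro card_image) (auto intro: inj_on_subset)
  then have cB: "card (g ` B) = rank P (ground P)"
    using B iso_map_rank_ground[OF MN.M.matroid_axioms MP PQ.M.indep_subset_ground] by simp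
  have "iso_map g N Q"
    unfolding iso_map_def
  proof (intro conjI allI impI)
    show "bij_betw g (ground N) (ground Q)"
      using inj imN by (auto simp: bij_betw_def intro: inj_on_subset)
    fix A assume A: "A \<subseteq> ground N"
    have "A \<in> indep N \<longleftrightarrow> B \<union> A \<in> indep (free_product M N)"
      using MN.indep_snd[OF B(2,3) A] by simp
    also have "\<dots> \<longleftrightarrow> g ` B \<union> g ` A \<in> indep (free_product P Q)"
      using ind[of "B \<union> A"] A B by (auto simp: image_Un)
    also have "\<dots> \<longleftrightarrow> g ` A \<in> indep Q"
      using PQ.indep_snd[OF gB cB, of "g ` A"] A imN by auto
    finally show "A \<in> indep N \<longleftrightarrow> g ` A \<in> indep Q" .
  qed
  then show ?thesis using MP by (auto simp: matroid_iso_def iso_map_def)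
qed

theorem corollary8:
  fixes M N :: "'a set_system" and P Q :: "'b set_system"
  assumes "matroid M" and "matroid N" and "matroid P" and "matroid Q"
    and "ground M \<inter> ground N = {}" and "ground P \<inter> ground Q = {}"
    and "matroid_iso (free_product M N) (free_product P Q)"
    and "card (ground M) = card (ground P)"
  shows "matroid_iso M P \<and> matroid_iso N Q"
proof -
  interpret MN: matroid_pair M N using assms by (simp add: matroid_pair_def matroid_pair_axioms_def)
  interpret PQ: matroid_pair P Q using assms by (simp add: matroid_pair_def matroid_pair_axioms_def)
  interpret L: matroid MN.L by (rule MN.matroid_free_product)
  obtain f where f: "iso_map f MN.L PQ.L" using assms(7) by (auto simp: matroid_iso_def iso_map_def)
  \<comment> \<open>The second free separator of the same matroid: the first ground set of the other
    decomposition, pulled back along \<open>f\<close>.\<close>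
  let ?U = "{x \<in> ground MN.L. f x \<in> ground P}"
  have inj: "inj_on f (ground MN.L)" and img: "f ` ground MN.L = ground PQ.L"
    using f by (auto simp: iso_map_def bij_betw_def)
  have sep: "free_separator MN.L ?U"
    using free_separator_vimage[OF f PQ.free_separator_fst] .
  have fU: "f ` ?U = ground P"
  proof
    show "ground P \<subseteq> f ` ?U"
    proof
      fix y assume y: "y \<in> ground P"
      then have "y \<in> f ` ground MN.L" unfolding img by simp
      then show "y \<in> f ` ?U" using y by auto
    qed
  qed auto
  have "card (f ` ?U) = card ?U" using inj by (intro card_image) (auto intro: inj_on_subset)
  then have card: "card (ground M) = card ?U" using fU assms(8) by simp
  obtain p where p: "bij_betw p (ground MN.L) (ground MN.L)" "p ` ground M = ?U"
      "\<And>x. (x \<in> ground M \<longleftrightarrow> x \<in> ?U) \<Longrightarrow> p x = x"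
    by (rule swap_bij_obtains[OF L.finite_ground _ _ card]) auto
  have "iso_map p MN.L MN.L"
    by (rule L.iso_map_swap_free_separators[OF MN.free_separator_fst sep card p(1) p(3)])
  \<comment> \<open>The automorphism \<open>p\<close> takes \<open>ground M\<close> to
    \<open>?U\<close>, which \<open>f\<close> takes to \<open>ground P\<close>; the composite
    therefore respects both decompositions.\<close>
  then have "iso_map (f \<circ> p) MN.L PQ.L" using f by (rule iso_map_comp)
  moreover have "(f \<circ> p) ` ground M = ground P" by (metis p(2) fU image_comp)
  ultimately show ?thesis
    using matroid_iso_factors MN.matroid_pair_axioms PQ.matroid_pair_axioms by blast
qed

end
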